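(* There exist positive constants $a$ and $b$ such that for all sufficiently large $n$, $$a\sqrt{n}\le\chi'_{C_4}(n)\le b\sqrt{n}\log n.$$
   Context: For a graph $G$ and a set $\mathcal H$ of small graphs, an $\mathcal H$-avoiding bipartite partition of $G$ is a collection of bipartite graphs $G_1,\dots,G_k$ (subgraphs of $G$) whose edge sets are pairwise disjoint with union $E(G)$, such that no $G_i$ contains any member of $\mathcal H$ as an induced subgraph. $\chi'_{\mathcal H}(G)$ is the smallest $k$ for which such a partition with $k$ graphs exists, and $\chi'_{\mathcal H}(n):=\chi'_{\mathcal H}(K_n)$, where $K_n$ is the complete graph on $n$ vertices; for $\mathcal H=\{H\}$ one writes $\chi'_H$. $C_4$ is the cycle on 4 vertices. *)

theory Defs
  imports Complex_Main
begin

text \<open>A graph is a pair of a vertex set and a set of edges, an edge being a two-element set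
  of vertices.\<close>

type_synonym 'a graph = "'a set \<times> 'a set set"

abbreviation verts :: "'a graph \<Rightarrow> 'a set" where
  "verts G \<equiv> fst G"

abbreviation edges :: "'a graph \<Rightarrow> 'a set set" where
  "edges G \<equiv> snd G"

definition simple_graph :: "'a graph \<Rightarrow> bool" where
  "simple_graph G \<longleftrightarrow> finite (verts G) \<and> (\<forall>e\<in>edges G. e \<subseteq> verts G \<and> card e = 2)"

definition subgraph :: "'a graph \<Rightarrow> 'a graph \<Rightarrow> bool" where
  "subgraph H G \<longleftrightarrow> simple_graph H \<and> verts H \<subseteq> verts G \<and> edges H \<subseteq> edges G"

definition bipartite :: "'a graph \<Rightarrow> bool" where
  "bipartite G \<longleftrightarrow>
     (\<exists>A B. A \<union> B = verts G \<and> A \<inter> B = {} \<and> (\<forall>e\<in>edges G. \<exists>a\<in>A. \<exists>b\<in>B. e = {a, b}))"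

definition induced_subgraph :: "'a graph \<Rightarrow> 'a set \<Rightarrow> 'a graph" where
  "induced_subgraph G S = (S, {e \<in> edges G. e \<subseteq> S})"

definition graph_iso :: "'a graph \<Rightarrow> 'b graph \<Rightarrow> bool" where
  "graph_iso G H \<longleftrightarrow>
     (\<exists>f. bij_betw f (verts G) (verts H) \<and> (\<lambda>e. f ` e) ` edges G = edges H)"

definition contains_induced :: "'a graph \<Rightarrow> 'b graph \<Rightarrow> bool" where
  "contains_induced G H \<longleftrightarrow> (\<exists>S\<subseteq>verts G. graph_iso H (induced_subgraph G S))"

definition avoiding_bipartite_partition ::
    "'b graph set \<Rightarrow> 'a graph \<Rightarrow> nat \<Rightarrow> (nat \<Rightarrow> 'a graph) \<Rightarrow> bool" where
  "avoiding_bipartite_partition \<H> G k P \<longleftrightarrow>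
     (\<forall>i\<in>{1..k}. subgraph (P i) G \<and> bipartite (P i) \<and>
        (\<forall>H\<in>\<H>. \<not> contains_induced (P i) H)) \<and>
     (\<forall>i\<in>{1..k}. \<forall>j\<in>{1..k}. i \<noteq> j \<longrightarrow> edges (P i) \<inter> edges (P j) = {}) \<and>
     (\<Union>i\<in>{1..k}. edges (P i)) = edges G"

text \<open>The value is meaningful only if some partition exists. This is the case whenever no member
  of the family is an induced subgraph of a single edge: take the edges of \<open>G\<close> one by one.\<close>

definition avoiding_index :: "'b graph set \<Rightarrow> 'a graph \<Rightarrow> nat" where
  "avoiding_index \<H> G = (LEAST k. \<exists>P. avoiding_bipartite_partition \<H> G k P)"

definition complete_graph :: "nat \<Rightarrow> nat graph" where
  "complete_graph n = ({..<n}, {e. e \<subseteq> {..<n} \<and> card e = 2})"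

definition C4 :: "nat graph" where
  "C4 = ({0, 1, 2, 3}, {{0, 1}, {1, 2}, {2, 3}, {3, 0}})"

end

theory Submission
  imports Defs "HOL-Algebra.Algebraic_Closure_Type" "HOL-Library.Z2"
begin

text \<open>
  A \<open>C\<^sub>4\<close> in a bipartite graph is automatically induced, since its diagonals would join vertices on
  the same side. For the lower bound, every pair of vertices of a \<open>C\<^sub>4\<close>-free graph has at most one
  common neighbour, so the number of paths of length two is at most \<open>n choose 2\<close>, and by convexity
  there are at most \<open>n powr (3/2)\<close> edges. For the upper bound, give the vertices distinct
  coordinates \<open>(x, y)\<close> in a field of order \<open>q = 2 ^ k\<close> with \<open>n \<le> q\<^sup>2\<close>, and colour the edge \<open>uv\<close> by
  \<open>y\<^sub>u + y\<^sub>v + x\<^sub>u x\<^sub>v\<close> together with the least binary digit in which \<open>u\<close> and \<open>v\<close> differ. If \<open>abcd\<close>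
  were a monochromatic \<open>C\<^sub>4\<close>, the alternating sum of its four edge colours would be
  \<open>(x\<^sub>a - x\<^sub>c) (x\<^sub>b - x\<^sub>d) = 0\<close>, which forces \<open>a = c\<close> or \<open>b = d\<close>; the digit makes every colour class
  bipartite. This uses \<open>O(q log n)\<close> colours.
\<close>

section \<open>Four-cycles\<close>

definition four_cycle :: "'a graph \<Rightarrow> 'a \<Rightarrow> 'a \<Rightarrow> 'a \<Rightarrow> 'a \<Rightarrow> bool" where
  "four_cycle G a b c d \<longleftrightarrow> a \<noteq> c \<and> b \<noteq> d \<and>
     {a, b} \<in> edges G \<and> {b, c} \<in> edges G \<and> {c, d} \<in> edges G \<and> {d, a} \<in> edges G"

definition four_cycle_free :: "'a graph \<Rightarrow> bool" where
  "four_cycle_free G \<longleftrightarrow> (\<forall>a b c d. \<not> four_cycle G a b c d)"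

lemma four_cycle_freeD: "four_cycle_free G \<Longrightarrow> \<not> four_cycle G a b c d"
  by (simp add: four_cycle_free_def)

lemma four_cycle_free_subset:
  "four_cycle_free G \<Longrightarrow> edges H \<subseteq> edges G \<Longrightarrow> four_cycle_free H"
  unfolding four_cycle_free_def four_cycle_def by blast

lemma bipartite_subset:
  assumes "bipartite G" "verts H = verts G" "edges H \<subseteq> edges G"
  shows "bipartite H"
proof -
  obtain A B where "A \<union> B = verts G" "A \<inter> B = {}" "\<forall>e\<in>edges G. \<exists>a\<in>A. \<exists>b\<in>B. e = {a, b}"
    using assms(1) by (auto simp: bipartite_def)
  then show ?thesis
    unfolding bipartite_def using assms(2,3) by (intro exI[of _ A] exI[of _ B]) auto
qed

lemma simple_graph_edgeD:
  assumes "simple_graph G" "{u, v} \<in> edges G"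
  shows "u \<in> verts G" "v \<in> verts G" "u \<noteq> v"
  using assms by (auto simp: simple_graph_def)

lemma simple_graph_edgeE:
  assumes "simple_graph G" "e \<in> edges G"
  obtains (doubleton) u v where "e = {u, v}" "u \<in> verts G" "v \<in> verts G" "u \<noteq> v"
  using assms that by (auto simp: simple_graph_def card_2_iff)

lemma finite_edges:
  assumes "simple_graph G"
  shows "finite (edges G)"
  by (rule finite_subset[of _ "Pow (verts G)"]) (use assms in \<open>auto simp: simple_graph_def\<close>)

lemma four_cycle_distinct:
  assumes "simple_graph G" "four_cycle G a b c d"
  shows "distinct [a, b, c, d]"
  using assms(2) simple_graph_edgeD(3)[OF assms(1)] by (auto simp: four_cycle_def)

lemma contains_induced_C4_imp_four_cycle:
  assumes "contains_induced G C4"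
  shows "\<exists>a b c d. four_cycle G a b c d"
proof -
  obtain S f where f: "bij_betw f {0, 1, 2, 3 :: nat} S"
    and edges: "(\<lambda>e. f ` e) ` {{0, 1}, {1, 2}, {2, 3}, {3, 0}} = {e \<in> edges G. e \<subseteq> S}"
    using assms by (auto simp: contains_induced_def graph_iso_def induced_subgraph_def C4_def)
  have "{f 0, f 1} \<in> edges G" "{f 1, f 2} \<in> edges G"
    "{f 2, f 3} \<in> edges G" "{f 3, f 0} \<in> edges G"
    using equalityD1[OF edges] by simp_all
  moreover have "f 0 \<noteq> f 2" "f 1 \<noteq> f 3"
    using bij_betw_imp_inj_on[OF f] by (auto simp: inj_on_def)
  ultimately have "four_cycle G (f 0) (f 1) (f 2) (f 3)"
    by (simp add: four_cycle_def)
  then show ?thesis by blast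
qed

lemma chordless_four_cycle_imp_contains_induced_C4:
  assumes G: "simple_graph G" and cycle: "four_cycle G a b c d"
    and chordless: "{a, c} \<notin> edges G" "{b, d} \<notin> edges G"
  shows "contains_induced G C4"
proof -
  let ?S = "{a, b, c, d}" and ?f = "(!) [a, b, c, d]"
  have bij: "bij_betw ?f {0, 1, 2, 3} ?S"
    by (intro bij_betw_nth four_cycle_distinct[OF G cycle]) auto
  have "e \<in> {{a, b}, {b, c}, {c, d}, {d, a}}" if "e \<in> edges G" "e \<subseteq> ?S" for e
    using G that(1)
  proof (cases rule: simple_graph_edgeE)
    case (doubleton u v)
    have "{u, v} \<noteq> {a, c}" "{u, v} \<noteq> {b, d}"
      using that(1) chordless unfolding doubleton(1) by metis+
    moreover have "u \<in> ?S" "v \<in> ?S"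
      using that(2) unfolding doubleton(1) by simp_all
    ultimately show ?thesis
      using doubleton(1,4) by (elim insertE emptyE) (simp_all add: insert_commute)
  qed
  then have "{e \<in> edges G. e \<subseteq> ?S} = {{a, b}, {b, c}, {c, d}, {d, a}}"
    using cycle by (auto simp: four_cycle_def)
  also have "\<dots> = (\<lambda>e. ?f ` e) ` {{0, 1}, {1, 2}, {2, 3}, {3, 0}}"
    by simp
  finally have "graph_iso C4 (induced_subgraph G ?S)"
    unfolding graph_iso_def induced_subgraph_def C4_def
    by (intro exI[of _ ?f]) (use bij in simp)
  moreover have "?S \<subseteq> verts G"
    using cycle simple_graph_edgeD[OF G] by (auto simp: four_cycle_def)
  ultimately show ?thesis unfolding contains_induced_def by blast
qed

lemma bipartite_triangle_free:
  assumes "bipartite G" "{a, b} \<in> edges G" "{b, c} \<in> edges G"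
  shows "{a, c} \<notin> edges G"
proof -
  obtain A B where disjoint: "A \<inter> B = {}"
    and edges: "\<And>e. e \<in> edges G \<Longrightarrow> \<exists>a\<in>A. \<exists>b\<in>B. e = {a, b}"
    using assms(1) by (auto simp: bipartite_def)
  have "u \<in> A \<and> v \<in> B \<or> u \<in> B \<and> v \<in> A" if "{u, v} \<in> edges G" for u v
    using edges[OF that] by (auto simp: doubleton_eq_iff)
  then show ?thesis using assms(2,3) disjoint by blast
qed

lemma bipartite_contains_induced_C4_iff:
  assumes "simple_graph G" "bipartite G"
  shows "contains_induced G C4 \<longleftrightarrow> \<not> four_cycle_free G"
proof
  assume "\<not> four_cycle_free G"
  then obtain a b c d where cycle: "four_cycle G a b c d"
    by (auto simp: four_cycle_free_def)
  then have "{a, c} \<notin> edges G" "{b, d} \<notin> edges G"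
    using bipartite_triangle_free[OF assms(2)] unfolding four_cycle_def by blast+
  then show "contains_induced G C4"
    using chordless_four_cycle_imp_contains_induced_C4[OF assms(1) cycle] by blast
qed (auto simp: four_cycle_free_def dest: contains_induced_C4_imp_four_cycle)

section \<open>Lower bound\<close>

definition neighbours :: "'a graph \<Rightarrow> 'a \<Rightarrow> 'a set" where
  "neighbours G v = {u. {v, u} \<in> edges G}"

lemma neighbours_subset: "simple_graph G \<Longrightarrow> neighbours G v \<subseteq> verts G"
  by (auto simp: neighbours_def dest: simple_graph_edgeD)

lemma card_neighbours:
  assumes "simple_graph G"
  shows "card (neighbours G v) = card {e \<in> edges G. v \<in> e}"
proof (rule bij_betw_same_card)
  have "e \<in> (\<lambda>u. {v, u}) ` neighbours G v" if "e \<in> edges G" "v \<in> e" for e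
    using assms that(1)
    by (cases rule: simple_graph_edgeE) (use that in \<open>auto simp: neighbours_def insert_commute\<close>)
  then show "bij_betw (\<lambda>u. {v, u}) (neighbours G v) {e \<in> edges G. v \<in> e}"
    by (auto simp: bij_betw_def inj_on_def doubleton_eq_iff neighbours_def)
qed

lemma sum_card_neighbours:
  assumes "simple_graph G"
  shows "(\<Sum>v\<in>verts G. card (neighbours G v)) = 2 * card (edges G)"
  unfolding card_neighbours[OF assms]
proof (rule sum_multicount)
  have "{v \<in> verts G. v \<in> e} = e" "card e = 2" if "e \<in> edges G" for e
    using assms that by (auto simp: simple_graph_def)
  then show "\<forall>e\<in>edges G. card {v \<in> verts G. v \<in> e} = 2" by simp
next
  show "finite (verts G)" "finite (edges G)"
    using assms finite_edges[OF assms] by (simp_all add: simple_graph_def)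
qed

lemma sum_choose_two_neighbours_le:
  assumes G: "simple_graph G" and free: "four_cycle_free G"
  shows "(\<Sum>v\<in>verts G. card (neighbours G v) choose 2) \<le> card (verts G) choose 2"
proof -
  define pairs where "pairs = {p. p \<subseteq> verts G \<and> card p = 2}"
  have fin: "finite (verts G)" "finite pairs"
    using G by (simp_all add: simple_graph_def pairs_def)
  have "card (neighbours G v) choose 2 = card {p \<in> pairs. p \<subseteq> neighbours G v}" for v
  proof -
    have "{p \<in> pairs. p \<subseteq> neighbours G v} = {p. p \<subseteq> neighbours G v \<and> card p = 2}"
      using neighbours_subset[OF G, of v] by (auto simp: pairs_def)
    then show ?thesis
      by (simp add: n_subsets finite_subset[OF neighbours_subset[OF G] fin(1)])
  qed
  then have "(\<Sum>v\<in>verts G. card (neighbours G v) choose 2) =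
      (\<Sum>p\<in>pairs. card {v \<in> verts G. p \<subseteq> neighbours G v})"
    using sum_multicount_gen[OF fin, of "\<lambda>v p. p \<subseteq> neighbours G v"] by simp
  also have "\<dots> \<le> (\<Sum>p\<in>pairs. 1)"
  proof (rule sum_mono)
    fix p assume "p \<in> pairs"
    then obtain a c where p: "p = {a, c}" "a \<noteq> c"
      by (auto simp: pairs_def card_2_iff)
    have "b = d" if "p \<subseteq> neighbours G b" "p \<subseteq> neighbours G d" for b d
      using four_cycle_freeD[OF free, of a b c d] p(2) that unfolding p(1)
      by (simp add: four_cycle_def neighbours_def insert_commute)
    then show "card {v \<in> verts G. p \<subseteq> neighbours G v} \<le> 1"
      using fin(1) by (auto simp: card_le_Suc0_iff_eq)
  qed
  also have "\<dots> = card (verts G) choose 2"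
    using n_subsets[OF fin(1), of 2] by (simp add: pairs_def)
  finally show ?thesis .
qed

lemma real_choose_two: "real (n choose 2) = (real n ^ 2 - real n) / 2"
  by (induction n) (simp_all add: numeral_2_eq_2 field_simps)

lemma sum_card_neighbours_squared_le:
  assumes G: "simple_graph G" and free: "four_cycle_free G"
  shows "(\<Sum>v\<in>verts G. real (card (neighbours G v)) ^ 2) \<le>
    real (card (verts G)) ^ 2 - real (card (verts G)) + 2 * real (card (edges G))"
proof -
  have "(\<Sum>v\<in>verts G. real (card (neighbours G v) choose 2)) \<le> real (card (verts G) choose 2)"
    using of_nat_mono[OF sum_choose_two_neighbours_le[OF assms], where 'a = real] by simp
  moreover have "(\<Sum>v\<in>verts G. real (card (neighbours G v))) = 2 * real (card (edges G))"
    using arg_cong[OF sum_card_neighbours[OF G], of real] by simp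
  ultimately show ?thesis
    by (simp add: real_choose_two sum_subtractf flip: sum_divide_distrib)
qed

lemma sum_mult_le_sum_squares:
  fixes f :: "'a \<Rightarrow> real"
  shows "2 * c * (\<Sum>x\<in>A. f x) \<le> (\<Sum>x\<in>A. f x ^ 2) + real (card A) * c ^ 2"
proof -
  have "2 * c * (\<Sum>x\<in>A. f x) = (\<Sum>x\<in>A. 2 * f x * c)"
    unfolding sum_distrib_left by (simp add: mult_ac)
  also have "\<dots> \<le> (\<Sum>x\<in>A. f x ^ 2 + c ^ 2)"
    by (intro sum_mono sum_squares_bound)
  finally show ?thesis by (simp add: sum.distrib)
qed

lemma card_edges_four_cycle_free_le:
  assumes G: "simple_graph G" and free: "four_cycle_free G"
  shows "real (card (edges G)) \<le> real (card (verts G)) * sqrt (real (card (verts G)))"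
proof (cases "verts G = {}")
  case True
  then have "edges G = {}" using G by (auto simp: simple_graph_def)
  then show ?thesis by simp
next
  case False
  define n m where "n = real (card (verts G))" and "m = real (card (edges G))"
  let ?d = "\<lambda>v. real (card (neighbours G v))"
  have n: "n \<ge> 1"
    using False G by (simp add: n_def simple_graph_def Suc_le_eq card_gt_0_iff)
  have "2 * sqrt n * (2 * m) = 2 * sqrt n * (\<Sum>v\<in>verts G. ?d v)"
    using arg_cong[OF sum_card_neighbours[OF G], of real] by (simp add: m_def)
  also have "\<dots> \<le> (\<Sum>v\<in>verts G. ?d v ^ 2) + n * sqrt n ^ 2"
    unfolding n_def by (rule sum_mult_le_sum_squares)
  also have "\<dots> \<le> 2 * (n * n) + 2 * m"
    using sum_card_neighbours_squared_le[OF assms] n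
    by (simp add: n_def m_def power2_eq_square)
  finally have "m * (2 * sqrt n - 1) \<le> n * n"
    by (simp add: algebra_simps)
  moreover have "m * sqrt n \<le> m * (2 * sqrt n - 1)"
    using n by (intro mult_left_mono) (auto simp: m_def)
  ultimately have "m * sqrt n \<le> (n * sqrt n) * sqrt n"
    using n by (simp add: mult.assoc)
  then show ?thesis
    using n by (simp add: m_def n_def)
qed

lemma card_edges_le_avoiding_partition:
  assumes G: "finite (verts G)" and C4: "C4 \<in> \<H>"
    and P: "avoiding_bipartite_partition \<H> G k P"
  shows "real (card (edges G)) \<le> real k * (real (card (verts G)) * sqrt (real (card (verts G))))"
proof -
  have edges_part: "real (card (edges (P i))) \<le> real (card (verts G)) * sqrt (real (card (verts G)))"
    if "i \<in> {1..k}" for i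
  proof -
    have P_i: "simple_graph (P i)" "bipartite (P i)" "\<not> contains_induced (P i) C4"
      and "verts (P i) \<subseteq> verts G"
      using P C4 that by (auto simp: avoiding_bipartite_partition_def subgraph_def)
    then have "card (verts (P i)) \<le> card (verts G)"
      using G by (simp add: card_mono)
    moreover have "four_cycle_free (P i)"
      using P_i bipartite_contains_induced_C4_iff by blast
    note card_edges_four_cycle_free_le[OF P_i(1) this]
    ultimately show ?thesis
      by (elim order_trans) (intro mult_mono, auto)
  qed
  have "card (edges G) = card (\<Union>i\<in>{1..k}. edges (P i))"
    using P by (simp add: avoiding_bipartite_partition_def)
  also have "\<dots> \<le> (\<Sum>i\<in>{1..k}. card (edges (P i)))"
    by (rule card_UN_le) simp
  finally have "real (card (edges G)) \<le> (\<Sum>i\<in>{1..k}. real (card (edges (P i))))"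
    by (simp flip: of_nat_sum)
  also have "\<dots> \<le> real k * (real (card (verts G)) * sqrt (real (card (verts G))))"
    using sum_bounded_above[of "{1..k}" "\<lambda>i. real (card (edges (P i)))", OF edges_part] by simp
  finally show ?thesis .
qed

corollary avoiding_partition_complete_graph_lower_bound:
  assumes P: "avoiding_bipartite_partition {C4} (complete_graph n) k P" and n: "n \<ge> 2"
  shows "1 / 4 * sqrt (real n) \<le> real k"
proof -
  have "(real n ^ 2 - real n) / 2 \<le> real k * (real n * sqrt (real n))"
    using card_edges_le_avoiding_partition[OF _ _ P] n_subsets[of "{..<n}" 2]
    by (simp add: complete_graph_def real_choose_two)
  then have "real n * ((real n - 1) / 2) \<le> real n * (real k * sqrt (real n))"
    by (simp add: power2_eq_square algebra_simps)
  then have "(real n - 1) / 2 \<le> real k * sqrt (real n)"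
    using n by simp
  then have "(1 / 4 * sqrt (real n)) * sqrt (real n) \<le> real k * sqrt (real n)"
    using n by simp
  then show ?thesis
    by (rule mult_right_le_imp_le) (use n in simp)
qed

section \<open>Edge colourings\<close>

definition colour_class :: "'a graph \<Rightarrow> ('a set \<Rightarrow> 'c) \<Rightarrow> 'c \<Rightarrow> 'a graph" where
  "colour_class G col t = (verts G, {e \<in> edges G. col e = t})"

lemma verts_colour_class [simp]: "verts (colour_class G col t) = verts G"
  and edges_colour_class [simp]: "edges (colour_class G col t) = {e \<in> edges G. col e = t}"
  by (simp_all add: colour_class_def)

lemma simple_colour_class: "simple_graph G \<Longrightarrow> simple_graph (colour_class G col t)"
  by (simp add: simple_graph_def)

lemma ex_avoiding_partition_of_colouring:
  assumes G: "simple_graph G" and C: "finite C" "col ` edges G \<subseteq> C"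
    and bip: "\<And>t. t \<in> C \<Longrightarrow> bipartite (colour_class G col t)"
    and avoid: "\<And>t H. t \<in> C \<Longrightarrow> H \<in> \<H> \<Longrightarrow> \<not> contains_induced (colour_class G col t) H"
  shows "\<exists>P. avoiding_bipartite_partition \<H> G (card C) P"
proof -
  obtain h where h: "bij_betw h {1..card C} C"
    using finite_same_card_bij[of "{1..card C}" C] C(1) by auto
  define P where "P i = colour_class G col (h i)" for i
  have "subgraph (P i) G" for i
    using simple_colour_class[OF G] by (auto simp: subgraph_def P_def)
  moreover have "h i \<in> C" if "i \<in> {1..card C}" for i
    using bij_betwE[OF h] that by blast
  moreover have "edges (P i) \<inter> edges (P j) = {}"
    if "i \<in> {1..card C}" "j \<in> {1..card C}" "i \<noteq> j" for i j
    using inj_onD[OF bij_betw_imp_inj_on[OF h] _ that(1,2)] that(3) by (auto simp: P_def)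
  moreover have "(\<Union>i\<in>{1..card C}. edges (P i)) = edges G"
  proof -
    have "(\<Union>i\<in>{1..card C}. edges (P i)) = {e \<in> edges G. col e \<in> h ` {1..card C}}"
      by (auto simp: P_def)
    also have "\<dots> = edges G"
      using C(2) bij_betw_imp_surj_on[OF h] by auto
    finally show ?thesis .
  qed
  ultimately have "avoiding_bipartite_partition \<H> G (card C) P"
    unfolding avoiding_bipartite_partition_def using bip avoid by (simp add: P_def)
  then show ?thesis by blast
qed

lemma ex_avoiding_partition_C4_of_product_colouring:
  assumes G: "simple_graph G"
    and C: "finite C" "f ` edges G \<subseteq> C" "\<And>s. bipartite (colour_class G f s)"
    and D: "finite D" "g ` edges G \<subseteq> D" "\<And>t. four_cycle_free (colour_class G g t)"
  shows "\<exists>P. avoiding_bipartite_partition {C4} G (card C * card D) P"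
proof -
  define col where "col e = (f e, g e)" for e
  have "\<exists>P. avoiding_bipartite_partition {C4} G (card (C \<times> D)) P"
  proof (rule ex_avoiding_partition_of_colouring[OF G, where col = col])
    show "finite (C \<times> D)" "col ` edges G \<subseteq> C \<times> D"
      using C(1,2) D(1,2) by (auto simp: col_def)
    show bip: "bipartite (colour_class G col st)" for st
      by (rule bipartite_subset[OF C(3)[of "fst st"]]) (auto simp: col_def)
    have "four_cycle_free (colour_class G col st)" for st
      by (rule four_cycle_free_subset[OF D(3)[of "snd st"]]) (auto simp: col_def)
    then show "\<not> contains_induced (colour_class G col st) H" if "H \<in> {C4}" for st H
      using that bipartite_contains_induced_C4_iff[OF simple_colour_class[OF G] bip] by simp
  qed
  then show ?thesis by (simp add: card_cartesian_product)
qed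

definition least_separating_bit :: "nat set \<Rightarrow> nat" where
  "least_separating_bit e = (LEAST i. \<exists>u\<in>e. \<exists>v\<in>e. bit u i \<noteq> bit v i)"

lemma bit_least_separating_bit:
  assumes "u \<noteq> v"
  shows "bit u (least_separating_bit {u, v}) \<noteq> bit v (least_separating_bit {u, v})"
proof -
  have "\<exists>i. \<exists>a\<in>{u, v}. \<exists>b\<in>{u, v}. bit a i \<noteq> bit b i"
    using assms by (auto simp: bit_eq_iff)
  from LeastI_ex[OF this] show ?thesis
    unfolding least_separating_bit_def by auto
qed

lemma bipartite_least_separating_bit:
  assumes G: "simple_graph G"
  shows "bipartite (colour_class G least_separating_bit i)"
proof -
  let ?A = "{v \<in> verts G. bit v i}" and ?B = "{v \<in> verts G. \<not> bit v i}"
  have "\<exists>a\<in>?A. \<exists>b\<in>?B. e = {a, b}" if e: "e \<in> edges G" "least_separating_bit e = i" for e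
    using G e(1)
  proof (cases rule: simple_graph_edgeE)
    case (doubleton u v)
    then have "bit u i \<noteq> bit v i"
      using bit_least_separating_bit e(2) by blast
    then show ?thesis
      using doubleton by (cases "bit u i") (auto simp: insert_commute)
  qed
  then show ?thesis
    unfolding bipartite_def by (intro exI[of _ ?A] exI[of _ ?B]) auto
qed

lemma least_separating_bit_less:
  assumes "u \<noteq> v" "u < 2 ^ L" "v < 2 ^ L"
  shows "least_separating_bit {u, v} < L"
proof -
  have "\<not> bit w i" if "w < 2 ^ L" "L \<le> i" for w i :: nat
  proof -
    have "w < 2 ^ i"
      using that(1) by (rule less_le_trans) (use that(2) in simp)
    then show ?thesis by (simp add: bit_iff_odd)
  qed
  then show ?thesis
    using bit_least_separating_bit[OF assms(1)] assms(2,3) by (meson not_le)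
qed

definition sum_prod_colour :: "('a \<Rightarrow> 'b) \<Rightarrow> ('a \<Rightarrow> 'b) \<Rightarrow> 'a set \<Rightarrow> 'b :: comm_semiring_1" where
  "sum_prod_colour x y e = (\<Sum>v\<in>e. y v) + (\<Prod>v\<in>e. x v)"

lemma sum_prod_colour_doubleton:
  "u \<noteq> v \<Longrightarrow> sum_prod_colour x y {u, v} = y u + y v + x u * x v"
  by (simp add: sum_prod_colour_def)

lemma four_cycle_free_sum_prod_colour:
  fixes x y :: "'a \<Rightarrow> 'b :: idom"
  assumes G: "simple_graph G" and inj: "inj_on (\<lambda>v. (x v, y v)) (verts G)"
  shows "four_cycle_free (colour_class G (sum_prod_colour x y) t)"
  unfolding four_cycle_free_def
proof (intro allI notI)
  fix a b c d assume cycle: "four_cycle (colour_class G (sum_prod_colour x y) t) a b c d"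
  have "y u + y v + x u * x v = t" if "{u, v} \<in> edges G" "sum_prod_colour x y {u, v} = t" for u v
    using that simple_graph_edgeD(3)[OF G] by (metis sum_prod_colour_doubleton)
  then have ab: "y a + y b + x a * x b = t" and bc: "y b + y c + x b * x c = t"
    and cd: "y c + y d + x c * x d = t" and da: "y d + y a + x d * x a = t"
    using cycle by (simp_all add: four_cycle_def)
  have "(x a - x c) * (x b - x d) =
      (y a + y b + x a * x b) - (y b + y c + x b * x c) +
      (y c + y d + x c * x d) - (y d + y a + x d * x a)"
    by (simp add: algebra_simps)
  also have "\<dots> = 0" unfolding ab bc cd da by simp
  finally consider (ac) "x a = x c" | (bd) "x b = x d" by auto
  then have "(x a, y a) = (x c, y c) \<or> (x b, y b) = (x d, y d)"
  proof cases
    case ac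
    then have "y a = y c"
      using trans[OF ab bc[symmetric]] by (simp add: algebra_simps)
    with ac show ?thesis by simp
  next
    case bd
    then have "y b = y d"
      using trans[OF bc cd[symmetric]] by (simp add: algebra_simps)
    with bd show ?thesis by simp
  qed
  moreover have "a \<in> verts G" "b \<in> verts G" "c \<in> verts G" "d \<in> verts G" "a \<noteq> c" "b \<noteq> d"
    using cycle simple_graph_edgeD(1,2)[OF G] by (auto simp: four_cycle_def)
  ultimately show False
    using inj_onD[OF inj, of a c] inj_onD[OF inj, of b d] by blast
qed

lemma ex_avoiding_partition_C4_of_finite_subring:
  fixes G :: "nat graph" and F :: "'b :: idom set"
  assumes G: "simple_graph G" "verts G \<subseteq> {..<2 ^ L}" "card (verts G) \<le> card F ^ 2"
    and F: "finite F" "\<And>a b. a \<in> F \<Longrightarrow> b \<in> F \<Longrightarrow> a + b \<in> F"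
      "\<And>a b. a \<in> F \<Longrightarrow> b \<in> F \<Longrightarrow> a * b \<in> F"
  shows "\<exists>P. avoiding_bipartite_partition {C4} G (L * card F) P"
proof -
  have "card (verts G) \<le> card (F \<times> F)"
    using G(3) by (simp add: card_cartesian_product power2_eq_square)
  then obtain z where z: "z ` verts G \<subseteq> F \<times> F" "inj_on z (verts G)"
    using card_le_inj[of "verts G" "F \<times> F"] G(1) F(1) by (auto simp: simple_graph_def)
  define x y where "x = fst \<circ> z" and "y = snd \<circ> z"
  have coords: "x v \<in> F" "y v \<in> F" if "v \<in> verts G" for v
    using z(1) that by (auto simp: x_def y_def mem_Times_iff)
  have "\<exists>P. avoiding_bipartite_partition {C4} G (card {..<L} * card F) P"
  proof (rule ex_avoiding_partition_C4_of_product_colouring[OF G(1)])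
    show "least_separating_bit ` edges G \<subseteq> {..<L}"
      using G(2) by (auto elim!: simple_graph_edgeE[OF G(1)] intro!: least_separating_bit_less)
    show "bipartite (colour_class G least_separating_bit i)" for i
      using G(1) by (rule bipartite_least_separating_bit)
    show "sum_prod_colour x y ` edges G \<subseteq> F"
      by (auto elim!: simple_graph_edgeE[OF G(1)] simp: sum_prod_colour_doubleton
          intro!: F(2,3) coords)
    show "four_cycle_free (colour_class G (sum_prod_colour x y) t)" for t
      using G(1) z(2) by (intro four_cycle_free_sum_prod_colour) (simp_all add: x_def y_def)
  qed (use F(1) in simp_all)
  then show ?thesis by simp
qed

section \<open>Finite subfields of algebraically closed fields\<close>

lemma size_proots_alg_closed:
  fixes p :: "'a :: alg_closed_field poly"
  assumes "p \<noteq> 0"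
  shows "size (proots p) = degree p"
proof -
  obtain A where A: "size A = degree p" "p = smult (lead_coeff p) (\<Prod>a\<in>#A. [:-a, 1:])"
    using alg_closed_imp_factorization[OF assms] by blast
  have "(\<Prod>a\<in>#B. [:-a, 1:]) \<noteq> 0" for B :: "'a multiset"
    by (auto simp: prod_mset_zero_iff)
  then have "proots (\<Prod>a\<in>#B. [:-a, 1:]) = B" for B :: "'a multiset"
    by (induction B) (simp_all add: proots_mult del: mult_pCons_left)
  then have "proots p = A"
    by (subst A(2)) (use assms in simp)
  then show ?thesis using A(1) by simp
qed

lemma order_eq_1I:
  fixes p :: "'a :: idom poly"
  assumes "poly p a = 0" "poly (pderiv p) a \<noteq> 0"
  shows "order a p = 1"
proof -
  have "p \<noteq> 0" using assms(2) by auto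
  have "\<not> [:-a, 1:] ^ 2 dvd p"
  proof
    assume "[:-a, 1:] ^ 2 dvd p"
    then obtain r where r: "p = [:-a, 1:] ^ 2 * r" by (rule dvdE)
    have "poly (pderiv p) a = 0"
      unfolding r power2_eq_square mult.assoc pderiv_mult by simp
    then show False using assms(2) by contradiction
  qed
  then have "order a p < 2"
    using \<open>p \<noteq> 0\<close> order_divides by (metis not_le)
  moreover have "order a p \<noteq> 0"
    using assms(1) \<open>p \<noteq> 0\<close> by (simp add: order_root)
  ultimately show ?thesis by simp
qed

lemma card_roots_eq_degree:
  fixes p :: "'a :: alg_closed_field poly"
  assumes separable: "\<And>a. poly p a = 0 \<Longrightarrow> poly (pderiv p) a \<noteq> 0"
  shows "card {a. poly p a = 0} = degree p"
proof -
  have p: "p \<noteq> 0" using separable by auto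
  have "degree p = (\<Sum>a | poly p a = 0. order a p)"
    using p by (simp add: size_multiset_overloaded_eq flip: size_proots_alg_closed)
  also have "\<dots> = (\<Sum>a | poly p a = 0. 1)"
    using order_eq_1I separable by (intro sum.cong) auto
  finally show ?thesis by simp
qed

definition frobenius_fixed_points :: "nat \<Rightarrow> 'a :: comm_semiring_1 set" where
  "frobenius_fixed_points k = {x. x ^ (CHAR('a) ^ k) = x}"

lemma frobenius_fixed_points_mult:
  "x \<in> frobenius_fixed_points k \<Longrightarrow> y \<in> frobenius_fixed_points k \<Longrightarrow>
    x * y \<in> frobenius_fixed_points k"
  by (simp add: frobenius_fixed_points_def power_mult_distrib)

lemma frobenius_fixed_points_add:
  fixes x y :: "'a :: comm_semiring_1"
  assumes "prime CHAR('a)" "x \<in> frobenius_fixed_points k" "y \<in> frobenius_fixed_points k"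
  shows "x + y \<in> frobenius_fixed_points k"
  using assms by (simp add: frobenius_fixed_points_def freshmans_dream')

lemma card_frobenius_fixed_points:
  assumes p: "CHAR('a :: alg_closed_field) > 0" and k: "k > 0"
  shows "card (frobenius_fixed_points k :: 'a set) = CHAR('a) ^ k"
proof -
  define q where "q = CHAR('a) ^ k"
  define f :: "'a poly" where "f = monom 1 q - monom 1 1"
  have "prime CHAR('a)" using p by (rule prime_CHAR_semidom)
  then have q: "q > 1"
    unfolding q_def using k by (intro one_less_power prime_gt_1_nat)
  then have degree: "degree f = q"
    unfolding f_def diff_conv_add_uminus
    by (subst degree_add_eq_left) (simp_all add: degree_monom_eq)
  have "of_nat q = (0 :: 'a)" using k by (simp add: q_def)
  then have "pderiv f = - 1"
    by (simp add: f_def pderiv_diff pderiv_monom monom_0 one_pCons)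
  then have "card {a. poly f a = 0} = q"
    using card_roots_eq_degree[of f] degree by simp
  then show ?thesis
    by (simp add: frobenius_fixed_points_def f_def poly_monom q_def)
qed

lemma CHAR_bit: "CHAR(bit) = 2"
proof (rule CHAR_eqI)
  fix n assume "of_nat n = (0 :: bit)"
  then have "even (of_nat n :: bit)" by simp
  then show "2 dvd n" by (simp only: even_of_nat_iff)
qed simp

section \<open>Upper bound\<close>

lemma ex_avoiding_partition_complete_graph:
  assumes k: "k > 0" and n: "n \<le> 4 ^ k"
  shows "\<exists>P. avoiding_bipartite_partition {C4} (complete_graph n) (2 * k * 2 ^ k) P"
proof -
  let ?F = "frobenius_fixed_points k :: bit alg_closure set"
  have card: "card ?F = 2 ^ k"
    using card_frobenius_fixed_points[OF _ k, where 'a = "bit alg_closure"] by (simp add: CHAR_bit)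
  have n_le: "n \<le> 2 ^ (2 * k)" using n by (simp add: power_mult)
  have "\<exists>P. avoiding_bipartite_partition {C4} (complete_graph n) (2 * k * card ?F) P"
  proof (rule ex_avoiding_partition_C4_of_finite_subring)
    show "simple_graph (complete_graph n)"
      by (auto simp: simple_graph_def complete_graph_def)
    show "verts (complete_graph n) \<subseteq> {..<2 ^ (2 * k)}"
      using n_le by (simp add: complete_graph_def)
    show "card (verts (complete_graph n)) \<le> card ?F ^ 2"
      using n_le by (simp add: complete_graph_def card power_even_eq)
    show "finite ?F" using card by (metis card.infinite power_not_zero zero_neq_numeral)
    show "a + b \<in> ?F" if "a \<in> ?F" "b \<in> ?F" for a b
      using that by (intro frobenius_fixed_points_add) (simp_all add: CHAR_bit)
    show "a * b \<in> ?F" if "a \<in> ?F" "b \<in> ?F" for a b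
      using that by (rule frobenius_fixed_points_mult)
  qed
  then show ?thesis by (simp add: card)
qed

lemma ex_avoiding_partition_complete_graph_le:
  assumes n: "n \<ge> 2"
  shows "\<exists>k P. avoiding_bipartite_partition {C4} (complete_graph n) k P \<and>
           real k \<le> 6 / ln 2 * sqrt (real n) * ln (real n)"
proof -
  obtain j where j: "4 ^ j < n" "n \<le> 4 ^ (j + 1)"
    using ex_power_ivl2[of 4 n] n by auto
  have "(2 ^ j) ^ 2 = real (4 ^ j)"
    by (simp add: power_mult flip: power_even_eq)
  also have "\<dots> < real n"
    using j(1) by (simp only: of_nat_less_iff)
  finally have four_power_less: "(2 ^ j) ^ 2 < real n" .
  then have two_power_le: "2 ^ j \<le> sqrt (real n)"
    by (simp add: real_le_rsqrt)
  have "ln ((2 ^ j) ^ 2) \<le> ln (real n)"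
    using four_power_less by (intro ln_mono) auto
  then have "2 * real j * ln 2 \<le> ln (real n)"
    by (simp add: ln_realpow)
  moreover have "ln 2 \<le> ln (real n)" using n by simp
  ultimately have "2 * real (j + 1) * ln 2 \<le> 3 * ln (real n)"
    by (simp add: algebra_simps)
  then have log_bound: "2 * real (j + 1) \<le> 3 * ln (real n) / ln 2"
    by (simp add: field_simps)
  have "real (2 * (j + 1) * 2 ^ (j + 1)) = 2 * real (j + 1) * 2 ^ (j + 1)"
    by (simp add: algebra_simps)
  also have "\<dots> \<le> 3 * ln (real n) / ln 2 * (2 * sqrt (real n))"
    using log_bound two_power_le n by (intro mult_mono) auto
  finally have "real (2 * (j + 1) * 2 ^ (j + 1)) \<le> 6 / ln 2 * sqrt (real n) * ln (real n)"
    by (simp add: mult_ac)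
  then show ?thesis
    using ex_avoiding_partition_complete_graph[OF _ j(2)] by fastforce
qed

lemma avoiding_index_le:
  "avoiding_bipartite_partition \<H> G k P \<Longrightarrow> avoiding_index \<H> G \<le> k"
  unfolding avoiding_index_def by (rule Least_le) (rule exI)

lemma avoiding_partition_avoiding_index:
  "avoiding_bipartite_partition \<H> G k P \<Longrightarrow>
    \<exists>Q. avoiding_bipartite_partition \<H> G (avoiding_index \<H> G) Q"
  unfolding avoiding_index_def by (rule LeastI) (rule exI)

theorem mainTheorem2:
  "\<exists>a b :: real. a > 0 \<and> b > 0 \<and>
     (\<forall>\<^sub>F n :: nat in sequentially.
        a * sqrt (real n) \<le> real (avoiding_index {C4} (complete_graph n)) \<and>
        real (avoiding_index {C4} (complete_graph n)) \<le> b * sqrt (real n) * ln (real n))"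
proof (intro exI conjI)
  show "(1 / 4 :: real) > 0" "6 / ln 2 > (0 :: real)" by simp_all
  show "\<forall>\<^sub>F n in sequentially.
        1 / 4 * sqrt (real n) \<le> real (avoiding_index {C4} (complete_graph n)) \<and>
        real (avoiding_index {C4} (complete_graph n)) \<le> 6 / ln 2 * sqrt (real n) * ln (real n)"
    using eventually_ge_at_top[of 2]
  proof eventually_elim
    case (elim n)
    obtain k P where P: "avoiding_bipartite_partition {C4} (complete_graph n) k P"
      and k: "real k \<le> 6 / ln 2 * sqrt (real n) * ln (real n)"
      using ex_avoiding_partition_complete_graph_le[OF elim] by blast
    have "1 / 4 * sqrt (real n) \<le> real (avoiding_index {C4} (complete_graph n))"
      using avoiding_partition_avoiding_index[OF P] elim
      by (blast intro: avoiding_partition_complete_graph_lower_bound)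
    moreover have "real (avoiding_index {C4} (complete_graph n)) \<le> real k"
      using avoiding_index_le[OF P] by simp
    ultimately show ?case using k by linarith
  qed
qed

end
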